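(* Let $G$ be a semigroup (with identity). If a colouring $G=C_1\cup\cdots\cup C_r$ is minimal, then each colour $C_i$, $i=1,\dots,r$, is a minimal set.
   Context: Semigroups are discrete and contain an identity element $e$. A topological dynamical $G$-system $(X,(T_g)_{g\in G})$ is a non-empty compact Hausdorff space $X$ with continuous maps $T_g:X\to X$ such that $T_{gh}=T_gT_h$ for all $g,h\in G$ and $T_e=\mathrm{id}_X$. A point $a\in X$ is transitive if $\{T_ga:g\in G\}$ is dense in $X$; the system is minimal if all its points are transitive. For bounded $f:G\to\mathbb{C}$, a $G$-system $(X,(T_g))$ is a Furstenberg system of $f$ if there exist $F\in C(X)$ and a transitive point $a\in X$ with $f(g)=F(T_ga)$ for all $g\in G$, and for any $x\ne y$ in $X$ there is $g\in G$ with $F(T_gx)\neq F(T_gy)$. It is unique up to topological isomorphism (equivariant homeomorphism), one realisation being the orbit closure of $f$ in $\overline{f(G)}^G$ under the right shift $R_g\big((x(u))_u\big)=(x(ug))_u$. A colouring $G=C_1\cup\cdots\cup C_r$ is a partition of $G$ into finitely many cells. It is minimal if the Furstenberg system of the function $f:G\to\{1,\dots,r\}$ defined by $f(g)=i$ if and only if $g\in C_i$ is a minimal system. A set $A\subset G$ is minimal if the Furstenberg system of its indicator function $\mathbb{1}_A:G\to\{0,1\}$ is a minimal system. *)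

theory Defs
  imports "HOL-Analysis.Analysis"
begin

text \<open>
  The semigroup with identity is a type of class \<^class>\<open>monoid_mult\<close> (not necessarily commutative).
  The compact space is a topology \<open>X\<close>, with underlying set \<open>topspace X\<close>; the maps \<open>T g\<close> matter only there.
\<close>

definition dynamical_system :: "'x topology \<Rightarrow> ('g::monoid_mult \<Rightarrow> 'x \<Rightarrow> 'x) \<Rightarrow> bool" where
  "dynamical_system X T \<longleftrightarrow>
     topspace X \<noteq> {} \<and> compact_space X \<and> Hausdorff_space X \<and>
     (\<forall>g. continuous_map X X (T g)) \<and>
     (\<forall>g h. \<forall>x\<in>topspace X. T (g * h) x = T g (T h x)) \<and>
     (\<forall>x\<in>topspace X. T 1 x = x)"

definition transitive_point :: "'x topology \<Rightarrow> ('g::monoid_mult \<Rightarrow> 'x \<Rightarrow> 'x) \<Rightarrow> 'x \<Rightarrow> bool" where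
  "transitive_point X T a \<longleftrightarrow> a \<in> topspace X \<and> X closure_of (range (\<lambda>g. T g a)) = topspace X"

definition minimal_system :: "'x topology \<Rightarrow> ('g::monoid_mult \<Rightarrow> 'x \<Rightarrow> 'x) \<Rightarrow> bool" where
  "minimal_system X T \<longleftrightarrow> dynamical_system X T \<and> (\<forall>a\<in>topspace X. transitive_point X T a)"

definition furstenberg_system ::
    "('g::monoid_mult \<Rightarrow> complex) \<Rightarrow> 'x topology \<Rightarrow> ('g \<Rightarrow> 'x \<Rightarrow> 'x) \<Rightarrow> bool" where
  "furstenberg_system f X T \<longleftrightarrow>
     dynamical_system X T \<and>
     (\<exists>F a. continuous_map X euclidean F \<and> transitive_point X T a \<and>
        (\<forall>g. f g = F (T g a)) \<and>
        (\<forall>x\<in>topspace X. \<forall>y\<in>topspace X. x \<noteq> y \<longrightarrow> (\<exists>g. F (T g x) \<noteq> F (T g y))))"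

text \<open>
  A definition can only quantify over spaces carried by a fixed type.  The type
  \<^typ>\<open>'g \<Rightarrow> complex\<close> is large enough: every bounded function has a Furstenberg system there
  (\<open>furstenberg_system_orbit_closure\<close> below), and the choice of the Furstenberg system, on this or
  any other type, is immaterial (\<open>minimal_function_iff\<close> below).
\<close>

definition minimal_function :: "('g::monoid_mult \<Rightarrow> complex) \<Rightarrow> bool" where
  "minimal_function f \<longleftrightarrow>
     (\<exists>(X :: ('g \<Rightarrow> complex) topology) T. furstenberg_system f X T \<and> minimal_system X T)"

text \<open>Cells may be empty; in particular the result covers partitions into non-empty cells.\<close>

definition colouring :: "nat \<Rightarrow> (nat \<Rightarrow> 'g set) \<Rightarrow> bool" where
  "colouring r C \<longleftrightarrow> disjoint_family_on C {1..r} \<and> (\<Union>i\<in>{1..r}. C i) = UNIV"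

definition colour_function :: "nat \<Rightarrow> (nat \<Rightarrow> 'g set) \<Rightarrow> 'g \<Rightarrow> complex" where
  "colour_function r C g = of_nat (THE i. i \<in> {1..r} \<and> g \<in> C i)"

definition minimal_colouring :: "nat \<Rightarrow> (nat \<Rightarrow> 'g::monoid_mult set) \<Rightarrow> bool" where
  "minimal_colouring r C \<longleftrightarrow> colouring r C \<and> minimal_function (colour_function r C)"

definition minimal_set :: "'g::monoid_mult set \<Rightarrow> bool" where
  "minimal_set A \<longleftrightarrow> minimal_function (indicator A)"


lemma colour_function_eq_iff:
  assumes "colouring r C" "i \<in> {1..r}"
  shows "colour_function r C g = of_nat i \<longleftrightarrow> g \<in> C i"
proof -
  have "g \<in> (\<Union>i\<in>{1..r}. C i)"
    using assms(1) by (simp add: colouring_def)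
  then obtain j where j: "j \<in> {1..r}" "g \<in> C j" by (rule UN_E)
  have uniq: "k = j" if "k \<in> {1..r}" "g \<in> C k" for k
  proof (rule ccontr)
    assume "k \<noteq> j"
    with that(1) j(1) assms(1) have "C k \<inter> C j = {}"
      unfolding colouring_def disjoint_family_on_def by simp
    with that(2) j(2) show False by blast
  qed
  have "(THE i. i \<in> {1..r} \<and> g \<in> C i) = j"
    by (rule the_equality) (use j uniq in blast)+
  then show ?thesis
    unfolding colour_function_def using j uniq[OF assms(2)] by (metis of_nat_eq_iff)
qed

definition right_shift :: "'g::monoid_mult \<Rightarrow> ('g \<Rightarrow> complex) \<Rightarrow> 'g \<Rightarrow> complex" where
  "right_shift g x = (\<lambda>u. x (u * g))"

abbreviation shift_space :: "('g \<Rightarrow> complex) topology" where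
  "shift_space \<equiv> product_topology (\<lambda>_. euclidean) UNIV"

definition orbit_closure :: "('g::monoid_mult \<Rightarrow> complex) \<Rightarrow> ('g \<Rightarrow> complex) topology" where
  "orbit_closure f =
     subtopology shift_space (shift_space closure_of (range (\<lambda>g. right_shift g f)))"

lemma topspace_orbit_closure:
  "topspace (orbit_closure f) = shift_space closure_of (range (\<lambda>g. right_shift g f))"
  unfolding orbit_closure_def by (simp add: closure_of_subset_topspace inf.absorb2)

lemma continuous_right_shift: "continuous_map shift_space shift_space (right_shift g)"
  unfolding right_shift_def
  by (auto simp: continuous_map_componentwise_UNIV intro: continuous_map_product_projection)

lemma Hausdorff_shift_space: "Hausdorff_space shift_space"
  by (simp add: Hausdorff_space_product_topology)

lemma furstenberg_system_orbit_closure: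
  fixes f :: "'g::monoid_mult \<Rightarrow> complex"
  assumes "bounded (range f)"
  shows "furstenberg_system f (orbit_closure f) right_shift"
proof -
  let ?O = "range (\<lambda>g. right_shift g f)"
  let ?K = "shift_space closure_of ?O"
  let ?B = "PiE UNIV (\<lambda>_::'g. closure (range f))"
  have cB: "compactin shift_space ?B"
    using assms by (simp add: compactin_PiE)
  have OB: "?O \<subseteq> ?B"
    using closure_subset by (fastforce simp: right_shift_def)
  have "closedin shift_space ?B"
    using cB Hausdorff_shift_space compactin_imp_closedin by blast
  then have KB: "?K \<subseteq> ?B" using OB by (rule closure_of_minimal[rotated])
  have "compactin shift_space ?K"
    using closed_compactin[OF cB KB closedin_closure_of] .
  then have comp: "compact_space (orbit_closure f)"
    unfolding orbit_closure_def by (simp add: compact_space_subtopology)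
  have haus: "Hausdorff_space (orbit_closure f)"
    unfolding orbit_closure_def by (simp add: Hausdorff_space_subtopology Hausdorff_shift_space)
  have mult: "right_shift (g * h) x = right_shift g (right_shift h x)" for g h and x :: "'g \<Rightarrow> complex"
    by (simp add: right_shift_def mult.assoc)
  have inv: "right_shift g ` ?K \<subseteq> ?K" for g
  proof -
    have "right_shift g ` ?K \<subseteq> shift_space closure_of (right_shift g ` ?O)"
      by (rule continuous_map_image_closure_subset[OF continuous_right_shift])
    also have "\<dots> \<subseteq> ?K"
      by (rule closure_of_mono) (auto simp flip: mult)
    finally show ?thesis .
  qed
  have cont: "continuous_map (orbit_closure f) (orbit_closure f) (right_shift g)" for g
    using inv[of g] continuous_map_from_subtopology[OF continuous_right_shift]
    unfolding orbit_closure_def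
    by (auto simp: continuous_map_in_subtopology)
  have sub: "?O \<subseteq> ?K" by (rule closure_of_subset) auto
  have one: "right_shift 1 x = x" for x :: "'g \<Rightarrow> complex" by (simp add: right_shift_def)
  have dyn: "dynamical_system (orbit_closure f) right_shift"
    unfolding dynamical_system_def
    using comp haus cont mult one sub by (auto simp: topspace_orbit_closure)
  have fin: "f \<in> ?K" using sub one[of f] by (metis rangeI subsetD)
  have trans: "transitive_point (orbit_closure f) right_shift f"
    unfolding transitive_point_def topspace_orbit_closure
    using fin sub by (simp add: orbit_closure_def closure_of_subtopology Int_absorb1)
  have F: "continuous_map (orbit_closure f) euclidean (\<lambda>x. x 1)"
    unfolding orbit_closure_def
    by (intro continuous_map_from_subtopology continuous_map_product_projection) simp
  have "\<exists>g. right_shift g x 1 \<noteq> right_shift g y 1" if "x \<noteq> y" for x y :: "'g \<Rightarrow> complex"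
    using that by (auto simp: right_shift_def fun_eq_iff)
  moreover have "f g = right_shift g f 1" for g by (simp add: right_shift_def)
  ultimately show ?thesis
    unfolding furstenberg_system_def using dyn F trans by blast
qed

lemma furstenberg_system_isomorphic_orbit_closure:
  fixes f :: "'g::monoid_mult \<Rightarrow> complex" and X :: "'x topology"
  assumes "furstenberg_system f X T"
  shows "\<exists>\<phi>. homeomorphic_map X (orbit_closure f) \<phi> \<and>
             (\<forall>g. \<forall>x\<in>topspace X. \<phi> (T g x) = right_shift g (\<phi> x))"
proof -
  obtain F a where F: "continuous_map X euclidean F" and a: "transitive_point X T a"
    and f: "\<And>g. f g = F (T g a)"
    and sep: "\<And>x y. x \<in> topspace X \<Longrightarrow> y \<in> topspace X \<Longrightarrow> x \<noteq> y \<Longrightarrow> \<exists>g. F (T g x) \<noteq> F (T g y)"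
    and dyn: "dynamical_system X T"
    using assms unfolding furstenberg_system_def by blast
  have comp: "compact_space X" and T: "\<And>g. continuous_map X X (T g)"
    and mult: "\<And>g h x. x \<in> topspace X \<Longrightarrow> T (g * h) x = T g (T h x)"
    using dyn unfolding dynamical_system_def by auto
  have aX: "a \<in> topspace X" and dense: "X closure_of (range (\<lambda>g. T g a)) = topspace X"
    using a unfolding transitive_point_def by auto
  define \<phi> where "\<phi> x = (\<lambda>g. F (T g x))" for x
  have cont: "continuous_map X shift_space \<phi>"
    unfolding \<phi>_def continuous_map_componentwise_UNIV
    using continuous_map_compose[OF T F] by (auto simp: o_def)
  have eqv: "\<phi> (T g x) = right_shift g (\<phi> x)" if "x \<in> topspace X" for g x
    using that by (simp add: \<phi>_def right_shift_def mult)
  have inj: "inj_on \<phi> (topspace X)"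
    using sep unfolding inj_on_def \<phi>_def by metis
  have "\<phi> a = f" by (auto simp: \<phi>_def f)
  then have orb: "\<phi> ` range (\<lambda>g. T g a) = range (\<lambda>g. right_shift g f)"
    using eqv[OF aX] by (auto simp: image_image)
  have closed: "closed_map X shift_space \<phi>"
    using T1_Spaces.continuous_imp_closed_map[OF cont comp Hausdorff_shift_space] .
  have sub: "range (\<lambda>g. T g a) \<subseteq> topspace X"
    using T aX by (auto simp: continuous_map_def)
  have "\<phi> ` topspace X = shift_space closure_of (range (\<lambda>g. right_shift g f))"
  proof
    show "\<phi> ` topspace X \<subseteq> shift_space closure_of (range (\<lambda>g. right_shift g f))"
      using continuous_map_image_closure_subset[OF cont, of "range (\<lambda>g. T g a)"]
      unfolding dense orb .
    have "closedin shift_space (\<phi> ` topspace X)"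
      using closed unfolding closed_map_def by blast
    then show "shift_space closure_of (range (\<lambda>g. right_shift g f)) \<subseteq> \<phi> ` topspace X"
      using sub unfolding orb[symmetric] by (intro closure_of_minimal image_mono)
  qed
  then have img: "\<phi> ` topspace X = topspace (orbit_closure f)"
    by (simp add: topspace_orbit_closure)
  have haus: "Hausdorff_space (orbit_closure f)"
    unfolding orbit_closure_def by (simp add: Hausdorff_space_subtopology Hausdorff_shift_space)
  have "continuous_map X (orbit_closure f) \<phi>"
    using cont img unfolding orbit_closure_def
    by (auto simp: continuous_map_in_subtopology)
  then have "homeomorphic_map X (orbit_closure f) \<phi>"
    using continuous_imp_homeomorphic_map[OF _ comp haus img inj] by blast
  then show ?thesis using eqv by blast
qed

lemma minimal_system_isomorphic:
  assumes "dynamical_system X T" "dynamical_system Y S" "homeomorphic_map X Y \<phi>"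
    and eqv: "\<And>g x. x \<in> topspace X \<Longrightarrow> \<phi> (T g x) = S g (\<phi> x)"
  shows "minimal_system X T \<longleftrightarrow> minimal_system Y S"
proof -
  have img: "\<phi> ` topspace X = topspace Y" and inj: "inj_on \<phi> (topspace X)"
    using assms(3) by (auto simp: homeomorphic_imp_surjective_map homeomorphic_imp_injective_map)
  have tp: "transitive_point Y S (\<phi> x) \<longleftrightarrow> transitive_point X T x" if x: "x \<in> topspace X" for x
  proof -
    have sub: "range (\<lambda>g. T g x) \<subseteq> topspace X"
      using assms(1) x unfolding dynamical_system_def continuous_map_def by auto
    have "range (\<lambda>g. S g (\<phi> x)) = \<phi> ` range (\<lambda>g. T g x)"
      using eqv[OF x] by (auto simp: image_image)
    then have "Y closure_of (range (\<lambda>g. S g (\<phi> x))) = \<phi> ` (X closure_of (range (\<lambda>g. T g x)))"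
      using homeomorphic_map_closure_of[OF assms(3) sub] by simp
    moreover have "\<phi> ` (X closure_of (range (\<lambda>g. T g x))) = \<phi> ` topspace X
                     \<longleftrightarrow> X closure_of (range (\<lambda>g. T g x)) = topspace X"
      by (intro inj_on_image_eq_iff[OF inj] closure_of_subset_topspace subset_refl)
    ultimately show ?thesis
      using x img unfolding transitive_point_def by auto
  qed
  show ?thesis
    unfolding minimal_system_def img[symmetric] using assms(1,2) tp by auto
qed

lemma furstenberg_system_imp_bounded:
  assumes "furstenberg_system f X T"
  shows "bounded (range f)"
proof -
  obtain F a where F: "continuous_map X euclidean F" and f: "\<And>g. f g = F (T g a)"
    and "transitive_point X T a" and dyn: "dynamical_system X T"
    using assms unfolding furstenberg_system_def by blast
  then have a: "a \<in> topspace X" and X: "compact_space X" and T: "\<And>g. continuous_map X X (T g)"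
    unfolding transitive_point_def dynamical_system_def by auto
  have "compactin euclidean (F ` topspace X)"
    using image_compactin[OF _ F] X unfolding compact_space_def by blast
  then have "bounded (F ` topspace X)" by (simp add: compact_imp_bounded)
  moreover have "range f \<subseteq> F ` topspace X"
    using f T a by (auto simp: continuous_map_def)
  ultimately show ?thesis by (rule bounded_subset)
qed

lemma minimal_system_iff_orbit_closure:
  assumes "furstenberg_system f X T"
  shows "minimal_system X T \<longleftrightarrow> minimal_system (orbit_closure f) right_shift"
proof -
  obtain \<phi> where hom: "homeomorphic_map X (orbit_closure f) \<phi>"
    and eqv: "\<forall>g. \<forall>x\<in>topspace X. \<phi> (T g x) = right_shift g (\<phi> x)"
    using furstenberg_system_isomorphic_orbit_closure[OF assms] by blast
  have "furstenberg_system f (orbit_closure f) right_shift"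
    by (rule furstenberg_system_orbit_closure[OF furstenberg_system_imp_bounded[OF assms]])
  then have "dynamical_system (orbit_closure f) right_shift" "dynamical_system X T"
    using assms by (simp_all add: furstenberg_system_def)
  then show ?thesis using hom eqv by (intro minimal_system_isomorphic) auto
qed

lemma minimal_function_iff:
  fixes f :: "'g::monoid_mult \<Rightarrow> complex" and X :: "'x topology"
  assumes "furstenberg_system f X T"
  shows "minimal_function f \<longleftrightarrow> minimal_system X T"
proof
  assume "minimal_function f"
  then obtain Y :: "('g \<Rightarrow> complex) topology" and S
    where "furstenberg_system f Y S" "minimal_system Y S"
    unfolding minimal_function_def by blast
  then have "minimal_system (orbit_closure f) right_shift"
    by (simp add: minimal_system_iff_orbit_closure)
  then show "minimal_system X T"
    by (simp add: minimal_system_iff_orbit_closure[OF assms])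
next
  assume "minimal_system X T"
  then have "minimal_system (orbit_closure f) right_shift"
    by (simp add: minimal_system_iff_orbit_closure[OF assms])
  with furstenberg_system_orbit_closure[OF furstenberg_system_imp_bounded[OF assms]]
  show "minimal_function f"
    unfolding minimal_function_def by blast
qed

end

(* The Furstenberg system of a function g \<mapsto> F (T g a) read off a minimal system is the image of that
   system under the code map x \<mapsto> (F (T g x))_g, and a factor of a minimal system is minimal.
   The indicator function of a colour is obtained in this way, because it is a continuous function
   of the colouring function. *)

theory Submission
  imports Defs
begin

text \<open>By surjectivity every point of \<open>Y\<close> is some \<open>\<phi> x\<close>.
  Continuity carries the dense orbit of \<open>x\<close> onto an orbit whose closure contains the
  whole image of \<open>X\<close>, hence all of \<open>Y\<close>.\<close>

lemma minimal_system_factor: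
  assumes min: "minimal_system X T" and dyn: "dynamical_system Y S"
    and cont: "continuous_map X Y \<phi>" and surj: "\<phi> ` topspace X = topspace Y"
    and eqv: "\<And>g x. x \<in> topspace X \<Longrightarrow> \<phi> (T g x) = S g (\<phi> x)"
  shows "minimal_system Y S"
proof -
  have "transitive_point Y S (\<phi> x)" if x: "x \<in> topspace X" for x
  proof -
    have "topspace Y = \<phi> ` (X closure_of range (\<lambda>g. T g x))"
      using min x surj by (simp add: minimal_system_def transitive_point_def)
    also have "\<dots> \<subseteq> Y closure_of (\<phi> ` range (\<lambda>g. T g x))"
      by (rule continuous_map_image_closure_subset[OF cont])
    also have "\<phi> ` range (\<lambda>g. T g x) = range (\<lambda>g. S g (\<phi> x))"
      using eqv[OF x] by (simp add: image_image)
    finally show ?thesis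
      using x surj closure_of_subset_topspace[of Y "range (\<lambda>g. S g (\<phi> x))"]
      unfolding transitive_point_def by blast
  qed
  then show ?thesis
    using dyn unfolding minimal_system_def surj[symmetric] by simp
qed

text \<open>Since \<open>F\<close> may fail to separate orbits, \<open>X\<close> itself can be too
  large to be a Furstenberg system; the code map identifies the points that \<open>F\<close> cannot
  tell apart.\<close>

lemma minimal_function_orbit_map:
  fixes X :: "'x topology" and T :: "'g::monoid_mult \<Rightarrow> 'x \<Rightarrow> 'x" and F :: "'x \<Rightarrow> complex"
  assumes min: "minimal_system X T" and F: "continuous_map X euclidean F" and a: "a \<in> topspace X"
  shows "minimal_function (\<lambda>g. F (T g a))"
proof -
  let ?f = "\<lambda>g. F (T g a)"
  have comp: "compact_space X" and T: "\<And>g. continuous_map X X (T g)"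
    and mult: "\<And>g h x. x \<in> topspace X \<Longrightarrow> T (g * h) x = T g (T h x)"
    and dense: "X closure_of range (\<lambda>g. T g a) = topspace X"
    using min a unfolding minimal_system_def dynamical_system_def transitive_point_def by auto
  have sub: "range (\<lambda>g. T g a) \<subseteq> topspace X"
    using T a by (auto simp: continuous_map_def)
  \<comment> \<open>Compactness of \<open>X\<close> bounds \<open>F\<close>, so the orbit closure of
    \<open>?f\<close> is a Furstenberg system of it.\<close>
  have "compactin euclidean (F ` topspace X)"
    using image_compactin[OF _ F] comp unfolding compact_space_def by blast
  moreover have "range ?f \<subseteq> F ` topspace X"
    using sub by blast
  ultimately have "bounded (range ?f)"
    by (metis bounded_subset compact_imp_bounded compactin_euclidean_iff)
  then have fs: "furstenberg_system ?f (orbit_closure ?f) right_shift"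
    by (rule furstenberg_system_orbit_closure)
  define \<phi> where "\<phi> x = (\<lambda>g. F (T g x))" for x
  have cont: "continuous_map X shift_space \<phi>"
    unfolding \<phi>_def continuous_map_componentwise_UNIV
    using continuous_map_compose[OF T F] by (auto simp: o_def)
  have eqv: "\<phi> (T g x) = right_shift g (\<phi> x)" if "x \<in> topspace X" for g x
    using that by (simp add: \<phi>_def right_shift_def mult)
  \<comment> \<open>The code of \<open>a\<close> is \<open>?f\<close> itself, so equivariance
    matches the two orbits.\<close>
  have orb: "\<phi> ` range (\<lambda>g. T g a) = range (\<lambda>g. right_shift g ?f)"
    using eqv[OF a] by (simp add: image_image \<phi>_def)
  \<comment> \<open>The image is closed and contains the orbit of \<open>?f\<close>, hence its
    closure; the reverse inclusion follows from density of the orbit of \<open>a\<close> and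
    continuity.\<close>
  have "closedin shift_space (\<phi> ` topspace X)"
    using T1_Spaces.continuous_imp_closed_map[OF cont comp Hausdorff_shift_space]
    unfolding closed_map_def by blast
  then have surj: "\<phi> ` topspace X = topspace (orbit_closure ?f)"
    unfolding topspace_orbit_closure orb[symmetric]
    using continuous_map_image_closure_subset[OF cont, of "range (\<lambda>g. T g a)"] sub
    unfolding dense by (intro equalityI closure_of_minimal image_mono)
  then have cont': "continuous_map X (orbit_closure ?f) \<phi>"
    using cont by (auto simp: orbit_closure_def continuous_map_in_subtopology)
  have dyn: "dynamical_system (orbit_closure ?f) right_shift"
    using fs unfolding furstenberg_system_def by (rule conjunct1)
  have "minimal_system (orbit_closure ?f) right_shift"
    by (rule minimal_system_factor[OF min dyn cont' surj])
       (rule eqv)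
  with fs show ?thesis
    unfolding minimal_function_def by blast
qed

text \<open>The same system and the same point serve, with \<open>p \<circ> F\<close> in place of
  \<open>F\<close>.\<close>

lemma minimal_function_compose:
  fixes p :: "complex \<Rightarrow> complex"
  assumes "minimal_function f" and p: "continuous_on UNIV p"
  shows "minimal_function (\<lambda>g. p (f g))"
proof -
  obtain X :: "('a \<Rightarrow> complex) topology" and T F a where min: "minimal_system X T"
    and F: "continuous_map X euclidean F" and a: "a \<in> topspace X" and f: "\<And>g. f g = F (T g a)"
    using assms(1) unfolding minimal_function_def furstenberg_system_def transitive_point_def
    by blast
  have "continuous_map X euclidean (p \<circ> F)"
    using continuous_map_compose[OF F, of euclidean p] p by simp
  from minimal_function_orbit_map[OF min this a] show ?thesis
    by (simp add: f)
qed

theorem corollary4p9: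
  fixes C :: "nat \<Rightarrow> 'g::monoid_mult set" and r :: nat
  assumes "minimal_colouring r C"
  shows "\<forall>i\<in>{1..r}. minimal_set (C i)"
proof
  fix i assume i: "i \<in> {1..r}"
  have col: "colouring r C" and min: "minimal_function (colour_function r C)"
    using assms by (simp_all add: minimal_colouring_def)
  \<comment> \<open>A tent of height and radius 1 around colour \<open>i\<close>: distinct naturals
    are at distance at least 1, so it vanishes at every other colour.\<close>
  define p :: "complex \<Rightarrow> complex" where "p z = of_real (max 0 (1 - dist z (of_nat i)))" for z
  have p: "p (of_nat n) = of_bool (n = i)" for n
    by (auto simp: p_def dist_of_nat)
  have "(\<lambda>g. p (colour_function r C g)) = indicator (C i)"
  proof
    fix g show "p (colour_function r C g) = indicator (C i) g"
      \<comment> \<open>Unfolding exposes the colour as \<open>of_nat\<close> of a natural number,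
        the form in which \<open>p\<close> was evaluated.\<close>
      using colour_function_eq_iff[OF col i, of g] unfolding colour_function_def p
      by (simp add: indicator_def)
  qed
  moreover have "continuous_on UNIV p"
    unfolding p_def by (intro continuous_intros)
  ultimately show "minimal_set (C i)"
    using minimal_function_compose[OF min, of p] by (simp add: minimal_set_def)
qed

end
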